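(* Let $R$ be an associative ring with unity and let $G$ be a subgroup of the multiplicative group $R^*$. Then, for every generalised homogeneous system of equations over $R$ in $n$ unknowns $x_1,\dots,x_n$, the number of solutions lying in $G^n$ is divisible by the order of $G\cap C(S)$, where $S$ is the set of coefficients of the system and $C(S)$ its centraliser in $R$.
   Context: An equation over $R$ with unknowns $X=\{x_1,\dots,x_n\}$ here has the form $\sum_i\prod_j c_{ij}x_{ij}^{k_{ij}}=0$ (finitely many terms, each a finite product) with coefficients $c_{ij}\in R$, $x_{ij}\in X$, exponents $k_{ij}\in\mathbb{Z}$. A system of such equations is generalised homogeneous if there is a nonzero map $\deg: X\to\mathbb{Z}$ such that, in each equation, $\sum_j k_{ij}\deg(x_{ij})$ does not depend on $i$ (same map $\deg$ for all equations). A solution is a tuple of ring elements which, substituted for the unknowns, satisfies all equations (components raised to negative powers must be invertible). Divisibility is in the sense of cardinal arithmetic: an infinite cardinal is divisible by every nonzero cardinal not exceeding it. *)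

theory Defs
  imports Main "HOL-Library.Equipollence"
begin

definition is_unit :: "'a::ring_1 \<Rightarrow> bool" where
  "is_unit x \<longleftrightarrow> (\<exists>y. x * y = 1 \<and> y * x = 1)"

definition inv_r :: "'a::ring_1 \<Rightarrow> 'a" where
  "inv_r x = (THE y. x * y = 1 \<and> y * x = 1)"

text \<open>Integer powers; only meaningful for units when the exponent is negative.\<close>
definition zpow :: "'a::ring_1 \<Rightarrow> int \<Rightarrow> 'a" where
  "zpow x k = (if 0 \<le> k then x ^ nat k else (inv_r x) ^ nat (- k))"

definition units_subgroup :: "'a::ring_1 set \<Rightarrow> bool" where
  "units_subgroup G \<longleftrightarrow> G \<subseteq> {x. is_unit x} \<and> 1 \<in> G \<and>
     (\<forall>x\<in>G. \<forall>y\<in>G. x * y \<in> G) \<and> (\<forall>x\<in>G. inv_r x \<in> G)"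

text \<open>A factor c * x_v^k is a triple (c, v, k); a term is the ordered product
  of its factors (a list); an equation  sum_i prod_j ... = 0  is a list of terms.\<close>
type_synonym 'a factor = "'a \<times> nat \<times> int"
type_synonym 'a eqn = "'a factor list list"

definition eval_term :: "(nat \<Rightarrow> 'a::ring_1) \<Rightarrow> 'a factor list \<Rightarrow> 'a" where
  "eval_term x t = foldr (\<lambda>(c, v, k) acc. c * zpow (x v) k * acc) t 1"

definition eval_eqn :: "(nat \<Rightarrow> 'a::ring_1) \<Rightarrow> 'a eqn \<Rightarrow> 'a" where
  "eval_eqn x e = sum_list (map (eval_term x) e)"

definition coeffs_of :: "'a eqn set \<Rightarrow> 'a set" where
  "coeffs_of E = {c. \<exists>e\<in>E. \<exists>t\<in>set e. \<exists>v k. (c, v, k) \<in> set t}"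

definition vars_below :: "nat \<Rightarrow> 'a eqn set \<Rightarrow> bool" where
  "vars_below n E \<longleftrightarrow> (\<forall>e\<in>E. \<forall>t\<in>set e. \<forall>(c, v, k)\<in>set t. v < n)"

definition term_degree :: "(nat \<Rightarrow> int) \<Rightarrow> 'a factor list \<Rightarrow> int" where
  "term_degree deg t = sum_list (map (\<lambda>(c, v, k). k * deg v) t)"

definition gen_homogeneous :: "nat \<Rightarrow> 'a eqn set \<Rightarrow> bool" where
  "gen_homogeneous n E \<longleftrightarrow> (\<exists>deg :: nat \<Rightarrow> int. (\<exists>i<n. deg i \<noteq> 0) \<and>
     (\<forall>e\<in>E. \<forall>t1\<in>set e. \<forall>t2\<in>set e. term_degree deg t1 = term_degree deg t2))"

definition centraliser :: "'a::ring_1 set \<Rightarrow> 'a set" where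
  "centraliser S = {r. \<forall>s\<in>S. r * s = s * r}"

definition solutions_in :: "nat \<Rightarrow> 'a::ring_1 set \<Rightarrow> 'a eqn set \<Rightarrow> 'a list set" where
  "solutions_in n G E = {xs. length xs = n \<and> set xs \<subseteq> G \<and>
     (\<forall>e\<in>E. eval_eqn (\<lambda>i. xs ! i) e = 0)}"

text \<open>Cardinal divisibility: |A| = |B| * c for some cardinal c.  Since any such c
  with B nonempty satisfies c \<le> |A|, and for B empty A is empty, c can be
  realised by a set of the same type as A.\<close>
definition card_dvd :: "'b set \<Rightarrow> 'a set \<Rightarrow> bool" where
  "card_dvd B A \<longleftrightarrow> (\<exists>C :: 'a set. A \<approx> B \<times> C)"

end

theory Submission
  imports Defs
begin

text \<open>
  Write \<open>H = G \<inter> C(S)\<close>. After dividing the degrees by their greatest common divisor, Bezout coefficients give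
  a monomial \<open>g = \<Prod>x\<^sub>i ^ m\<^sub>i\<close> of degree 1, and a solution is encoded as the pair \<open>(g, y)\<close> with
  \<open>y\<^sub>i = x\<^sub>i g ^ - deg x\<^sub>i\<close> of degree 0. Let \<open>N\<close> be the largest \<open>g\<close>-invariant subset of
  \<open>H \<inter> C(y)\<close>; it is a subgroup. Solutions are preserved by conjugation with elements of \<open>H\<close> and by the
  twists \<open>(g, y) \<mapsto> (g h, y)\<close> with \<open>h \<in> N\<close>: a term of degree \<open>D\<close> has the form \<open>e g ^ D\<close>, where \<open>e\<close>
  commutes with \<open>N\<close> and is unchanged by the twist. Both kinds of moves generate an equivalence relation.
  Twisting does not change \<open>N\<close>, the twists of a pair form a class of size \<open>|N|\<close>, and the stabiliser of this
  class in \<open>H\<close> is exactly \<open>N\<close>. Hence every block has \<open>|H : N| |N| = |H|\<close> elements.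
\<close>

subsection \<open>Units and conjugation\<close>

lemma inv_r_props:
  assumes "is_unit (x::'a::ring_1)"
  shows "x * inv_r x = 1" "inv_r x * x = 1"
proof -
  obtain y where y: "x * y = 1" "y * x = 1"
    using assms by (auto simp: is_unit_def)
  have "\<exists>!z. x * z = 1 \<and> z * x = 1"
    by (metis y mult.assoc mult_1_left mult_1_right)
  from theI'[OF this] show "x * inv_r x = 1" "inv_r x * x = 1"
    by (auto simp: inv_r_def)
qed

lemma inv_r_cancel:
  assumes "is_unit (x::'a::ring_1)"
  shows "x * (inv_r x * z) = z" "inv_r x * (x * z) = z"
  using inv_r_props[OF assms] by (simp_all flip: mult.assoc)

lemma inv_r_unique:
  assumes "(x::'a::ring_1) * y = 1" "y * x = 1"
  shows "inv_r x = y"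
proof -
  have "is_unit x" using assms by (auto simp: is_unit_def)
  from inv_r_cancel(2)[OF this, of y] show ?thesis using assms by simp
qed

lemma is_unit_one: "is_unit (1::'a::ring_1)"
  by (auto simp: is_unit_def)

lemma is_unit_inv_r: "is_unit x \<Longrightarrow> is_unit (inv_r (x::'a::ring_1))"
  using inv_r_props[of x] unfolding is_unit_def by blast

lemma inv_r_inv_r: "is_unit x \<Longrightarrow> inv_r (inv_r x) = (x::'a::ring_1)"
  by (intro inv_r_unique inv_r_props)

lemma inv_r_one: "inv_r (1::'a::ring_1) = 1"
  by (intro inv_r_unique) auto

lemma mult_inv_r_inv_r:
  assumes "is_unit (x::'a::ring_1)" "is_unit y"
  shows "x * y * (inv_r y * inv_r x) = 1" "inv_r y * inv_r x * (x * y) = 1"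
  using assms by (simp_all add: mult.assoc inv_r_cancel inv_r_props)

lemma inv_r_mult:
  "is_unit x \<Longrightarrow> is_unit y \<Longrightarrow> inv_r (x * y) = inv_r y * inv_r (x::'a::ring_1)"
  by (intro inv_r_unique mult_inv_r_inv_r)

lemma is_unit_mult: "is_unit x \<Longrightarrow> is_unit y \<Longrightarrow> is_unit (x * y::'a::ring_1)"
  using mult_inv_r_inv_r[of x y] unfolding is_unit_def by blast

lemmas unit_intros = is_unit_one is_unit_inv_r is_unit_mult
lemmas unit_simps = unit_intros inv_r_cancel inv_r_props inv_r_mult inv_r_inv_r inv_r_one mult.assoc

section \<open>Conjugation by units\<close>

definition conjugate :: "'a::ring_1 \<Rightarrow> 'a \<Rightarrow> 'a" where
  "conjugate a x = a * x * inv_r a"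

lemma conjugate_mult: "is_unit a \<Longrightarrow> conjugate a (x * y) = conjugate a x * conjugate a y"
  by (simp add: conjugate_def unit_simps)

lemma conjugate_add: "conjugate a (x + y) = conjugate a x + conjugate a y"
  by (simp add: conjugate_def algebra_simps)

lemma conjugate_zero: "conjugate a 0 = 0"
  by (simp add: conjugate_def)

lemma conjugate_right_one: "is_unit a \<Longrightarrow> conjugate a 1 = 1"
  by (simp add: conjugate_def unit_simps)

lemma conjugate_one: "conjugate 1 x = x"
  by (simp add: conjugate_def unit_simps)

lemma conjugate_conjugate:
  "is_unit a \<Longrightarrow> is_unit b \<Longrightarrow> conjugate a (conjugate b x) = conjugate (a * b) x"
  by (simp add: conjugate_def unit_simps)

lemma conjugate_inv_r_cancel:
  assumes "is_unit a"
  shows "conjugate a (conjugate (inv_r a) x) = x" "conjugate (inv_r a) (conjugate a x) = x"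
  using assms by (simp_all add: conjugate_def unit_simps)

lemma is_unit_conjugate: "is_unit a \<Longrightarrow> is_unit x \<Longrightarrow> is_unit (conjugate a x)"
  by (simp add: conjugate_def unit_intros)

lemma conjugate_inv_r:
  "is_unit a \<Longrightarrow> is_unit x \<Longrightarrow> conjugate a (inv_r x) = inv_r (conjugate a x)"
  by (simp add: conjugate_def unit_simps)

lemma conjugate_eq_self_iff:
  assumes "is_unit a"
  shows "conjugate a x = x \<longleftrightarrow> a * x = x * a"
proof
  assume "conjugate a x = x"
  then have "conjugate a x * a = x * a" by simp
  then show "a * x = x * a" using assms by (simp add: conjugate_def unit_simps)
qed (use assms in \<open>simp add: conjugate_def unit_simps\<close>)

section \<open>Integer powers of units\<close>

lemma zpow_zero: "zpow x 0 = 1"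
  by (simp add: zpow_def)

lemma zpow_one: "zpow x 1 = x"
  by (simp add: zpow_def)

lemma zpow_succ:
  assumes "is_unit x"
  shows "zpow x (k + 1) = zpow x k * x"
proof (cases "0 \<le> k")
  case True
  then have "nat (k + 1) = Suc (nat k)" by simp
  with True show ?thesis by (simp add: zpow_def power_commutes)
next
  case False
  define l where "l = nat (- (k + 1))"
  have "nat (- k) = Suc l" using False by (simp add: l_def)
  then have "zpow x k * x = inv_r x ^ l"
    using False assms unfolding zpow_def by (simp add: power_Suc2 unit_simps del: power_Suc)
  \<comment> \<open>For \<open>k = -1\<close> the exponent \<open>k + 1\<close> is 0 and takes the
    nonnegative branch of \<open>zpow\<close>; both sides are then 1.\<close>
  moreover have "zpow x (k + 1) = inv_r x ^ l"
    using False unfolding zpow_def l_def by (cases "k + 1 = 0") auto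
  ultimately show ?thesis by simp
qed

lemma zpow_pred:
  assumes "is_unit x"
  shows "zpow x (k - 1) = zpow x k * inv_r x"
  using zpow_succ[OF assms, of "k - 1"] assms by (simp add: unit_simps)

lemma zpow_add:
  assumes "is_unit x"
  shows "zpow x (j + k) = zpow x j * zpow x k"
proof (induction k rule: int_induct[of _ 0])
  case base
  show ?case by (simp add: zpow_zero)
next
  case (step1 k)
  then show ?case
    using zpow_succ[OF assms, of k] zpow_succ[OF assms, of "j + k"] by (simp add: add.assoc mult.assoc)
next
  case (step2 k)
  then show ?case
    using zpow_pred[OF assms, of k] zpow_pred[OF assms, of "j + k"] by (simp add: algebra_simps)
qed

lemma is_unit_zpow: "is_unit x \<Longrightarrow> is_unit (zpow x k)"
  using zpow_add[of x k "- k"] zpow_add[of x "- k" k] unfolding is_unit_def by (auto simp: zpow_zero)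

lemma zpow_minus: "is_unit x \<Longrightarrow> zpow x (- k) = inv_r (zpow x k)"
  using zpow_add[of x k "- k"] zpow_add[of x "- k" k] by (intro inv_r_unique[symmetric]) (auto simp: zpow_zero)

lemma zpow_closed:
  assumes "\<And>x y. x \<in> A \<Longrightarrow> y \<in> A \<Longrightarrow> x * y \<in> A" "1 \<in> A" "x \<in> A" "inv_r x \<in> A" "is_unit x"
  shows "zpow x k \<in> A"
  by (induction k rule: int_induct[of _ 0])
     (use assms in \<open>auto simp: zpow_zero zpow_succ zpow_pred\<close>)

lemma conjugate_zpow:
  assumes "is_unit a" "is_unit x"
  shows "conjugate a (zpow x k) = zpow (conjugate a x) k"
  by (induction k rule: int_induct[of _ 0])
     (use assms in \<open>simp_all add: zpow_zero zpow_succ zpow_pred conjugate_right_one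
        conjugate_mult conjugate_inv_r is_unit_conjugate\<close>)

section \<open>Subgroups of units and centralisers\<close>

lemma
  assumes "units_subgroup G"
  shows units_subgroup_unit: "x \<in> G \<Longrightarrow> is_unit x"
    and units_subgroup_one: "1 \<in> G"
    and units_subgroup_mult: "x \<in> G \<Longrightarrow> y \<in> G \<Longrightarrow> x * y \<in> G"
    and units_subgroup_inv: "x \<in> G \<Longrightarrow> inv_r x \<in> G"
  using assms by (auto simp: units_subgroup_def)

lemmas subgroup_intros = units_subgroup_one units_subgroup_mult units_subgroup_inv

lemma units_subgroup_conjugate:
  "units_subgroup G \<Longrightarrow> a \<in> G \<Longrightarrow> x \<in> G \<Longrightarrow> conjugate a x \<in> G"
  by (simp add: conjugate_def subgroup_intros)

lemma units_subgroup_zpow: "units_subgroup G \<Longrightarrow> x \<in> G \<Longrightarrow> zpow x k \<in> G"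
  by (intro zpow_closed) (auto intro: subgroup_intros units_subgroup_unit)

lemma centraliser_mult: "x \<in> centraliser S \<Longrightarrow> y \<in> centraliser S \<Longrightarrow> x * y \<in> centraliser S"
  unfolding centraliser_def by (auto, metis mult.assoc)

lemma centraliser_one: "1 \<in> centraliser S"
  by (simp add: centraliser_def)

lemma centraliser_iff_conjugate:
  "is_unit x \<Longrightarrow> x \<in> centraliser S \<longleftrightarrow> (\<forall>s\<in>S. conjugate x s = s)"
  by (simp add: centraliser_def conjugate_eq_self_iff)

lemma centraliser_inv_r:
  assumes "is_unit x" "x \<in> centraliser S"
  shows "inv_r x \<in> centraliser S"
  using assms by (auto simp: centraliser_iff_conjugate is_unit_inv_r) (metis conjugate_inv_r_cancel(2))

lemma units_subgroup_Int_centraliser: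
  assumes "units_subgroup G"
  shows "units_subgroup (G \<inter> centraliser S)"
  using assms unfolding units_subgroup_def
  by (auto intro: centraliser_mult centraliser_one centraliser_inv_r)

lemma centraliser_conjugate:
  assumes "is_unit a" "x \<in> centraliser S"
  shows "conjugate a x \<in> centraliser (conjugate a ` S)"
  using assms by (auto simp: centraliser_def simp flip: conjugate_mult)

subsection \<open>The core of a subgroup\<close>

\<comment> \<open>For a unit \<open>g\<close> this is the intersection of all conjugates of
  \<open>Y\<close> by integer powers of \<open>g\<close>. The greatest fixed point form avoids those
  powers: membership is proved by exhibiting one invariant subset of \<open>Y\<close>.\<close>
coinductive_set core :: "'a::ring_1 \<Rightarrow> 'a set \<Rightarrow> 'a set" for g Y where
  coreI: "h \<in> Y \<Longrightarrow> conjugate g h \<in> core g Y \<Longrightarrow> conjugate (inv_r g) h \<in> core g Y \<Longrightarrow> h \<in> core g Y"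

lemma
  assumes "h \<in> core g Y"
  shows core_in: "h \<in> Y"
    and core_conjugate: "conjugate g h \<in> core g Y"
    and core_conjugate_inv: "conjugate (inv_r g) h \<in> core g Y"
  using assms by (auto elim: core.cases)

lemma core_maximal:
  assumes "h \<in> A" "A \<subseteq> Y"
    and "\<And>x. x \<in> A \<Longrightarrow> conjugate g x \<in> A" "\<And>x. x \<in> A \<Longrightarrow> conjugate (inv_r g) x \<in> A"
  shows "h \<in> core g Y"
  using assms(1) by (rule core.coinduct[of "\<lambda>x. x \<in> A", simplified]) (use assms in auto)

text \<open>Conjugation by a unit respects products and inverses, so the products of core elements,
  and likewise their inverses, form invariant subsets of \<open>Y\<close>.\<close>

lemma units_subgroup_core:
  assumes "units_subgroup Y" "is_unit g"
  shows "units_subgroup (core g Y)"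
  unfolding units_subgroup_def
proof (intro conjI ballI subsetI CollectI)
  note [dest] = core_in and [intro] = core_conjugate core_conjugate_inv
  show "is_unit x" if "x \<in> core g Y" for x
    using core_in[OF that] units_subgroup_unit assms by blast
  show "1 \<in> core g Y"
    by (rule core_maximal[of _ "{1}"]) (use assms in \<open>auto simp: conjugate_right_one unit_intros subgroup_intros\<close>)
  show "x * y \<in> core g Y" if "x \<in> core g Y" "y \<in> core g Y" for x y
  proof (rule core_maximal)
    let ?A = "{x * y |x y. x \<in> core g Y \<and> y \<in> core g Y}"
    show "x * y \<in> ?A" using that by blast
    show "?A \<subseteq> Y" using assms by (auto intro!: subgroup_intros)
    show "conjugate g z \<in> ?A" if "z \<in> ?A" for z
      using that assms(2) conjugate_mult[of g] by auto
    show "conjugate (inv_r g) z \<in> ?A" if "z \<in> ?A" for z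
      using that conjugate_mult[OF is_unit_inv_r[OF assms(2)]] by auto
  qed
  show "inv_r x \<in> core g Y" if "x \<in> core g Y" for x
  proof (rule core_maximal)
    show "inv_r x \<in> {inv_r x |x. x \<in> core g Y}" using that by blast
  next
    fix z assume "z \<in> {inv_r x |x. x \<in> core g Y}"
    then obtain x where x: "z = inv_r x" "x \<in> core g Y" by blast
    have "is_unit x" using core_in[OF x(2)] units_subgroup_unit assms by blast
    then show "conjugate g z \<in> {inv_r x |x. x \<in> core g Y}"
      "conjugate (inv_r g) z \<in> {inv_r x |x. x \<in> core g Y}"
      using x assms(2) by (auto simp: conjugate_inv_r is_unit_inv_r)
  qed (use assms in \<open>auto intro!: subgroup_intros\<close>)
qed

text \<open>Conjugation by \<open>g * h\<close> is conjugation by \<open>h\<close>, which preserves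
  the core because the core is a subgroup containing \<open>h\<close>, followed by conjugation by
  \<open>g\<close>.\<close>

lemma core_mult_subset:
  assumes "units_subgroup Y" "is_unit g" "h \<in> core g Y"
  shows "core g Y \<subseteq> core (g * h) Y"
proof
  note N = units_subgroup_core[OF assms(1,2)]
  have h: "is_unit h" using units_subgroup_unit[OF N assms(3)] .
  fix x assume "x \<in> core g Y"
  then show "x \<in> core (g * h) Y"
  proof (rule core_maximal)
    show "conjugate (g * h) x \<in> core g Y" if "x \<in> core g Y" for x
      using core_conjugate[OF units_subgroup_conjugate[OF N assms(3) that]] h assms(2)
      by (simp add: conjugate_conjugate)
    show "conjugate (inv_r (g * h)) x \<in> core g Y" if "x \<in> core g Y" for x
      using units_subgroup_conjugate[OF N units_subgroup_inv[OF N assms(3)] core_conjugate_inv[OF that]]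
        h assms(2) by (simp add: conjugate_conjugate inv_r_mult is_unit_inv_r)
  qed (auto dest: core_in)
qed

lemma core_mult:
  assumes "units_subgroup Y" "is_unit g" "h \<in> core g Y"
  shows "core (g * h) Y = core g Y"
proof
  note N = units_subgroup_core[OF assms(1,2)]
  have h: "is_unit h" using units_subgroup_unit[OF N assms(3)] .
  \<comment> \<open>The reverse inclusion is the first one again, for \<open>g * h\<close> twisted
    back by \<open>inv_r h\<close>, which by the first inclusion lies in the core of
    \<open>g * h\<close>.\<close>
  have "inv_r h \<in> core (g * h) Y"
    using core_mult_subset[OF assms] units_subgroup_inv[OF N assms(3)] by blast
  from core_mult_subset[OF assms(1) _ this] show "core (g * h) Y \<subseteq> core g Y"
    using assms(2) h by (simp add: unit_simps)
qed (rule core_mult_subset[OF assms])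

lemma conjugate_core:
  assumes "is_unit a" "is_unit g" "h \<in> core g Y"
  shows "conjugate a h \<in> core (conjugate a g) (conjugate a ` Y)"
proof (rule core_maximal)
  show "conjugate a h \<in> conjugate a ` core g Y" using assms by blast
  show "conjugate a ` core g Y \<subseteq> conjugate a ` Y" by (auto dest: core_in)
  have *: "conjugate (conjugate a b) (conjugate a z) = conjugate a (conjugate b z)"
    if "is_unit b" for b z
    using assms that by (simp add: conjugate_def unit_simps)
  show "conjugate (conjugate a g) x \<in> conjugate a ` core g Y" if "x \<in> conjugate a ` core g Y" for x
    using that assms by (auto simp: * intro: core_conjugate)
  show "conjugate (inv_r (conjugate a g)) x \<in> conjugate a ` core g Y" if "x \<in> conjugate a ` core g Y" for x
    using that assms by (auto simp: * is_unit_inv_r core_conjugate_inv simp flip: conjugate_inv_r)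
qed

lemma core_mono: "Y \<subseteq> Y' \<Longrightarrow> core g Y \<subseteq> core g Y'"
  by (rule subsetI, rule core_maximal[of _ "core g Y"])
     (auto dest: core_in intro: core_conjugate core_conjugate_inv)

text \<open>From \<open>c * g = g * n * c\<close> it follows that conjugation by
  \<open>inv_r g\<close> sends \<open>c\<close> to \<open>n * c\<close>, and conjugation by
  \<open>g\<close> sends \<open>c\<close> to \<open>inv_r (conjugate g n) * c\<close>. Hence the
  coset of the core through \<open>c\<close> is an invariant subset of \<open>Y\<close>. This is why
  the stabiliser of a twist class is no larger than the core.\<close>

lemma core_absorb:
  assumes "units_subgroup Y" "is_unit g" "c \<in> Y" "n \<in> core g Y" "conjugate c g = g * n"
  shows "c \<in> core g Y"
proof (rule core_maximal)
  note N = units_subgroup_core[OF assms(1,2)]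
  have c: "is_unit c" and n: "is_unit n"
    using units_subgroup_unit[OF assms(1,3)] units_subgroup_unit[OF N assms(4)] by auto
  have "c * g = conjugate c g * c" using c by (simp add: conjugate_def unit_simps)
  also have "\<dots> = g * (n * c)" by (simp add: assms(5) mult.assoc)
  finally have 1: "conjugate (inv_r g) c = n * c"
    using assms(2) by (simp add: conjugate_def unit_simps)
  have "c = conjugate g n * conjugate g c"
    using conjugate_inv_r_cancel(1)[OF assms(2), of c] assms(2) by (simp add: 1 conjugate_mult)
  then have 2: "conjugate g c = inv_r (conjugate g n) * c"
    using inv_r_cancel(2)[of "conjugate g n" "conjugate g c"] assms(2) n by (simp add: is_unit_conjugate)
  let ?A = "(\<lambda>m. m * c) ` core g Y"
  show "c \<in> ?A" using units_subgroup_one[OF N] by (auto intro: image_eqI[of _ _ 1])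
  show "?A \<subseteq> Y" using assms by (auto intro: subgroup_intros dest: core_in)
  have A: "m * (k * c) \<in> ?A" if "m \<in> core g Y" "k \<in> core g Y" for m k
    using units_subgroup_mult[OF N that] by (auto simp flip: mult.assoc)
  show "conjugate g x \<in> ?A" if "x \<in> ?A" for x
    using that assms(2,4)
    by (auto simp: conjugate_mult 2 intro!: A units_subgroup_inv[OF N] core_conjugate)
  show "conjugate (inv_r g) x \<in> ?A" if "x \<in> ?A" for x
    using that assms(2,4)
    by (auto simp: conjugate_mult 1 is_unit_inv_r intro!: A core_conjugate_inv)
qed

subsection \<open>Orbits of twisted conjugation\<close>

text \<open>One representative is chosen per block, and a representative together with a point of
  \<open>B\<close> determines an element. Taking \<open>C\<close> inside \<open>A\<close>, rather
  than as a set of blocks, lets it be pulled back later to a set of solutions.\<close>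

lemma eqpoll_Times_of_blocks:
  assumes "\<And>x. x \<in> A \<Longrightarrow> R x x"
    and "\<And>x y. x \<in> A \<Longrightarrow> y \<in> A \<Longrightarrow> R x y \<Longrightarrow> R y x"
    and "\<And>x y z. x \<in> A \<Longrightarrow> y \<in> A \<Longrightarrow> z \<in> A \<Longrightarrow> R x y \<Longrightarrow> R y z \<Longrightarrow> R x z"
    and blocks: "\<And>x. x \<in> A \<Longrightarrow> B \<approx> {y \<in> A. R x y}"
  shows "\<exists>C\<subseteq>A. A \<approx> B \<times> C"
proof -
  define r where "r x = (SOME y. y \<in> A \<and> R x y)" for x
  have r: "r x \<in> A \<and> R x (r x)" if "x \<in> A" for x
    unfolding r_def by (rule someI[of _ x]) (use assms(1) that in simp)
  have r_eq: "r x = r y" if "x \<in> A" "y \<in> A" "R x y" for x y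
  proof -
    have "(z \<in> A \<and> R x z) = (z \<in> A \<and> R y z)" for z
      using assms(3)[of x y z] assms(3)[of y x z] assms(2)[of x y] that by blast
    then show ?thesis by (simp add: r_def)
  qed
  have "\<forall>x\<in>A. \<exists>f. bij_betw f B {y \<in> A. R x y}"
    using blocks unfolding eqpoll_def by blast
  then obtain f where f: "bij_betw (f x) B {y \<in> A. R x y}" if "x \<in> A" for x
    by metis
  have f_in: "f x b \<in> A \<and> R x (f x b)" if "x \<in> A" "b \<in> B" for x b
    using bij_betwE[OF f[OF that(1)]] that(2) by blast
  have r_idem: "r (r x) = r x" if "x \<in> A" for x
    using r_eq[of x "r x"] r[OF that] that by simp
  have r_f: "r (f (r x) b) = r x" if "x \<in> A" "b \<in> B" for x b
    using r_eq[of "r x" "f (r x) b"] f_in[of "r x" b] r[OF that(1)] r_idem[OF that(1)] that by simp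
  have "bij_betw (\<lambda>(b, c). f c b) (B \<times> r ` A) A"
    unfolding bij_betw_def
  proof
    show "inj_on (\<lambda>(b, c). f c b) (B \<times> r ` A)"
    proof (rule inj_onI, clarify)
      fix b b' x x' assume *: "b \<in> B" "b' \<in> B" "x \<in> A" "x' \<in> A" "f (r x) b = f (r x') b'"
      then have "r x = r x'" using r_f[of x b] r_f[of x' b'] by simp
      moreover have "b = b'"
        using * \<open>r x = r x'\<close> f[of "r x"] r[of x] by (simp add: bij_betw_def inj_on_def)
      ultimately show "b = b' \<and> r x = r x'" by simp
    qed
    show "(\<lambda>(b, c). f c b) ` (B \<times> r ` A) = A"
    proof (intro equalityI subsetI)
      fix y assume y: "y \<in> A"
      then have "y \<in> {z \<in> A. R (r y) z}" using r[OF y] assms(2) by blast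
      then have "y \<in> f (r y) ` B"
        using bij_betw_imp_surj_on[OF f, of "r y"] r[OF y] by simp
      then obtain b where "b \<in> B" "y = f (r y) b" by (rule imageE)
      then show "y \<in> (\<lambda>(b, c). f c b) ` (B \<times> r ` A)"
        using y by (intro image_eqI[of _ _ "(b, r y)"]) simp_all
    next
      fix y assume "y \<in> (\<lambda>(b, c). f c b) ` (B \<times> r ` A)"
      then obtain b x where "y = f (r x) b" "b \<in> B" "x \<in> A" by auto
      then show "y \<in> A" using f_in[of "r x" b] r[of x] by blast
    qed
  qed
  then have "A \<approx> B \<times> r ` A" using eqpoll_def eqpoll_sym by blast
  moreover have "r ` A \<subseteq> A" using r by blast
  ultimately show ?thesis by blast
qed

section \<open>Pairs, their cores and their moves\<close>

definition pair_core :: "'a::ring_1 set \<Rightarrow> 'a \<times> 'a list \<Rightarrow> 'a set" where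
  "pair_core H p = core (fst p) (H \<inter> centraliser (set (snd p)))"

text \<open>A twist by \<open>h\<close> followed by conjugation by \<open>a\<close>. With the twist
  first, \<open>h\<close> can be taken from the core of the original pair \<open>p\<close>.\<close>

definition pair_move :: "'a::ring_1 \<Rightarrow> 'a \<Rightarrow> 'a \<times> 'a list \<Rightarrow> 'a \<times> 'a list" where
  "pair_move a h p = (conjugate a (fst p * h), map (conjugate a) (snd p))"

lemma units_subgroup_pair_core:
  "units_subgroup H \<Longrightarrow> is_unit (fst p) \<Longrightarrow> units_subgroup (pair_core H p)"
  unfolding pair_core_def by (intro units_subgroup_core units_subgroup_Int_centraliser)

lemma pair_core_conjugate_subset:
  assumes "units_subgroup H" "a \<in> H" "is_unit (fst p)" "h \<in> pair_core H p"
  shows "conjugate a h \<in> pair_core H (pair_move a 1 p)"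
proof -
  have a: "is_unit a" using assms units_subgroup_unit by blast
  have "conjugate a ` (H \<inter> centraliser (set (snd p))) \<subseteq> H \<inter> centraliser (conjugate a ` set (snd p))"
    using assms a by (auto intro: units_subgroup_conjugate centraliser_conjugate)
  from core_mono[OF this] show ?thesis
    using conjugate_core[OF a assms(3) assms(4)[unfolded pair_core_def]]
    by (auto simp: pair_core_def pair_move_def)
qed

lemma pair_core_twist:
  assumes "units_subgroup H" "is_unit (fst p)" "h \<in> pair_core H p"
  shows "core (fst p * h) (H \<inter> centraliser (set (snd p))) = pair_core H p"
  using core_mult[OF units_subgroup_Int_centraliser[OF assms(1)] assms(2)] assms(3)
  by (simp add: pair_core_def)

text \<open>A twist leaves the core unchanged, and conjugation by \<open>a\<close> carries it along;
  the inclusion missing from \<open>pair_core_conjugate_subset\<close> comes from applying it to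
  \<open>inv_r a\<close>.\<close>

lemma pair_core_move:
  assumes "units_subgroup H" "a \<in> H" "is_unit (fst p)" "h \<in> pair_core H p"
  shows "pair_core H (pair_move a h p) = conjugate a ` pair_core H p"
proof -
  have a: "is_unit a" and ia: "inv_r a \<in> H" and h: "is_unit h"
    using assms units_subgroup_unit units_subgroup_inv units_subgroup_pair_core by blast+
  let ?p = "(fst p * h, snd p)"
  have core: "pair_core H ?p = pair_core H p"
    using pair_core_twist[OF assms(1,3,4)] by (simp add: pair_core_def)
  have p: "is_unit (fst ?p)" using assms h by (simp add: is_unit_mult)
  have move: "pair_move a h p = pair_move a 1 ?p" by (simp add: pair_move_def)
  have move_back: "pair_move (inv_r a) 1 (pair_move a 1 ?p) = ?p"
    using a by (simp add: pair_move_def conjugate_inv_r_cancel map_idI)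
  have q: "is_unit (fst (pair_move a 1 ?p))"
    using a p by (simp add: pair_move_def is_unit_conjugate)
  show ?thesis unfolding move core[symmetric]
  proof (intro equalityI subsetI)
    fix x assume "x \<in> pair_core H (pair_move a 1 ?p)"
    from pair_core_conjugate_subset[OF assms(1) ia q this]
    have "conjugate (inv_r a) x \<in> pair_core H ?p" unfolding move_back .
    then show "x \<in> conjugate a ` pair_core H ?p"
      using a by (intro image_eqI[of _ _ "conjugate (inv_r a) x"]) (auto simp: conjugate_inv_r_cancel)
  qed (use pair_core_conjugate_subset[OF assms(1,2) p] in auto)
qed

text \<open>In the applications the second twist comes from the core of the moved pair, hence has
  the form \<open>conjugate a k\<close> with \<open>k\<close> in the core of \<open>p\<close>;
  composites of moves are then moves.\<close>

lemma pair_move_move: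
  assumes "is_unit a" "is_unit b"
  shows "pair_move b (conjugate a k) (pair_move a h p) = pair_move (b * a) (h * k) p"
  using assms by (simp add: pair_move_def conjugate_conjugate mult.assoc flip: conjugate_mult)

lemma pair_move_one: "pair_move 1 1 p = p"
  by (cases p) (simp add: pair_move_def conjugate_one map_idI)

text \<open>A block is an equivalence class of the relation generated by the moves. Moving by \<open>t * n\<close> with \<open>n\<close> in the core amounts to moving by \<open>t\<close> with another twist, so a block is
  parametrised by a coset representative \<open>t\<close> of the core in \<open>H\<close> together with a twist, hence by \<open>H\<close>.\<close>
lemma block_eqpoll_subgroup:
  fixes p :: "'a::ring_1 \<times> 'a list"
  assumes H: "units_subgroup H" and p: "is_unit (fst p)"
  shows "H \<approx> {q. \<exists>a\<in>H. \<exists>h\<in>pair_core H p. q = pair_move a h p}"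
proof -
  define N where "N = pair_core H p"
  define Y where "Y = H \<inter> centraliser (set (snd p))"
  let ?g = "fst p"
  have Y: "units_subgroup Y" unfolding Y_def by (rule units_subgroup_Int_centraliser[OF H])
  have N_core: "N = core ?g Y" by (simp add: N_def Y_def pair_core_def)
  have N: "units_subgroup N" unfolding N_def by (rule units_subgroup_pair_core[OF H p])
  have NY: "N \<subseteq> Y" unfolding N_core by (auto dest: core_in)
  have YH: "Y \<subseteq> H" by (simp add: Y_def)
  have unitH: "is_unit a" if "a \<in> H" for a using that H units_subgroup_unit by blast
  have unitN: "is_unit a" if "a \<in> N" for a using that N units_subgroup_unit by blast
  \<comment> \<open>\<open>inv_r a * t \<in> N\<close> says that \<open>t\<close> lies in the left
    coset of \<open>N\<close> through \<open>a\<close>. The choice of \<open>r a\<close> fixes one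
    factorisation of \<open>a\<close> into a representative and an element of
    \<open>N\<close>.\<close>
  define r where "r a = (SOME t. t \<in> H \<and> inv_r a * t \<in> N)" for a
  have r: "r a \<in> H \<and> inv_r a * r a \<in> N" if "a \<in> H" for a
    unfolding r_def by (rule someI[of _ a])
      (use that in \<open>simp add: inv_r_props unitH units_subgroup_one[OF N]\<close>)
  have r_eq: "r a = r b" if "a \<in> H" "b \<in> H" "inv_r a * b \<in> N" for a b
  proof -
    have u: "is_unit a" "is_unit b" using that unitH by auto
    have "inv_r a * t \<in> N \<longleftrightarrow> inv_r b * t \<in> N" for t
      using units_subgroup_mult[OF N that(3), of "inv_r b * t"]
        units_subgroup_mult[OF N units_subgroup_inv[OF N that(3)], of "inv_r a * t"] u
      by (auto simp: unit_simps)
    then show ?thesis by (simp add: r_def)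
  qed
  define f where "f a = pair_move (r a) (inv_r (r a) * a) p" for a
  have tw: "inv_r (r a) * a \<in> N" if "a \<in> H" for a
    using units_subgroup_inv[OF N, of "inv_r a * r a"] r[OF that] unitH that by (simp add: unit_simps)
  have "inj_on f H"
  proof (rule inj_onI)
    fix a b assume a: "a \<in> H" and b: "b \<in> H" and eq: "f a = f b"
    note ua = unitH[OF a] and ub = unitH[OF b]
    have ura: "is_unit (r a)" and urb: "is_unit (r b)" using a b r unitH by auto
    \<comment> \<open>Equal images mean that \<open>c\<close>, which compares the two
      representatives, fixes every entry of \<open>snd p\<close> and conjugates one twist of
      \<open>?g\<close> into the other.\<close>
    define c where "c = inv_r (r b) * r a"
    define h where "h = inv_r (r a) * a"
    define k where "k = inv_r (r b) * b"
    have hk: "h \<in> N" "k \<in> N" using tw a b by (auto simp: h_def k_def)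
    note uh = unitN[OF hk(1)] and uk = unitN[OF hk(2)]
    have cH: "c \<in> H" unfolding c_def using r a b H by (auto intro: subgroup_intros)
    have move: "conjugate (inv_r (r b)) (conjugate (r a) x) = conjugate c x" for x
      using ura urb by (simp add: c_def conjugate_conjugate is_unit_inv_r)
    have g: "conjugate c (?g * h) = ?g * k"
      using eq urb unfolding f_def pair_move_def h_def[symmetric] k_def[symmetric]
      by (simp flip: move) (simp add: conjugate_inv_r_cancel)
    have "conjugate c y = y" if "y \<in> set (snd p)" for y
    proof -
      have "conjugate (r a) y = conjugate (r b) y"
        using eq that by (simp add: f_def pair_move_def)
      then show ?thesis using urb by (simp flip: move) (simp add: conjugate_inv_r_cancel)
    qed
    then have cY: "c \<in> Y" using cH unitH by (simp add: Y_def centraliser_iff_conjugate)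
    have N': "core (?g * h) Y = N"
      using pair_core_twist[OF H p] hk by (simp add: N_def Y_def)
    \<comment> \<open>\<open>core_absorb\<close> applies to the twisted element
      \<open>?g * h\<close>, whose core is again \<open>N\<close>, with remaining twist
      \<open>inv_r h * k\<close>.\<close>
    have "c \<in> core (?g * h) Y"
    proof (rule core_absorb[OF Y _ cY])
      show "inv_r h * k \<in> core (?g * h) Y"
        unfolding N' using hk N by (auto intro: subgroup_intros)
      show "conjugate c (?g * h) = ?g * h * (inv_r h * k)"
        using uh by (simp add: g unit_simps)
    qed (use p uh in \<open>simp add: unit_intros\<close>)
    then have "inv_r c \<in> N" unfolding N' by (rule units_subgroup_inv[OF N])
    \<comment> \<open>The product telescopes to \<open>inv_r a * b\<close>, so \<open>a\<close> and
      \<open>b\<close> lie in the same coset; then \<open>c = 1\<close> and the twists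
      agree.\<close>
    then have "inv_r a * r a * inv_r c * k \<in> N"
      using r[OF a] hk N by (auto intro: subgroup_intros)
    then have "inv_r a * b \<in> N"
      using ua ub ura urb by (simp add: c_def k_def unit_simps)
    then have rab: "r a = r b" using r_eq a b by blast
    then have "c = 1" using ura by (simp add: c_def unit_simps)
    then have "inv_r ?g * (?g * h) = inv_r ?g * (?g * k)" using g by (simp add: conjugate_one)
    then have "h = k" using p by (simp add: inv_r_cancel)
    then have "r a * h = r a * k" by simp
    then show "a = b" using ura rab by (simp add: h_def k_def inv_r_cancel)
  qed
  moreover have "f ` H = {q. \<exists>a\<in>H. \<exists>h\<in>N. q = pair_move a h p}"
  proof (intro equalityI subsetI)
    fix q assume "q \<in> {q. \<exists>a\<in>H. \<exists>h\<in>N. q = pair_move a h p}"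
    then obtain a h where a: "a \<in> H" and h: "h \<in> N" and q: "q = pair_move a h p" by blast
    define n where "n = inv_r (r a) * a"
    have n: "n \<in> N" using tw[OF a] by (simp add: n_def)
    have ra: "r a \<in> H" "is_unit (r a)" and un: "is_unit n" using r[OF a] unitH n unitN by auto
    have a_eq: "a = r a * n" using ra by (simp add: n_def inv_r_cancel)
    \<comment> \<open>\<open>k\<close> solves \<open>?g * k = conjugate n (?g * h)\<close>: the
      factor \<open>n\<close> of \<open>a\<close>, which fixes \<open>snd p\<close>, is absorbed
      into the twist. It lies in \<open>N\<close> because \<open>N\<close> is invariant under
      conjugation by \<open>inv_r ?g\<close>.\<close>
    define k where "k = conjugate (inv_r ?g) n * h * inv_r n"
    have k: "k \<in> N"
      unfolding k_def using n h core_conjugate_inv[of n ?g Y] by (auto simp flip: N_core intro!: subgroup_intros[OF N])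
    have gk: "?g * k = conjugate n (?g * h)"
      using p un by (simp add: k_def conjugate_def unit_simps)
    have ny: "conjugate n y = y" if "y \<in> set (snd p)" for y
      using that n NY un by (auto simp: Y_def centraliser_iff_conjugate)
    \<comment> \<open>This element has representative \<open>r a\<close> and twist \<open>k\<close>,
      so \<open>f\<close> sends it to \<open>q\<close>.\<close>
    define x where "x = r a * k"
    have x: "x \<in> H" unfolding x_def using ra k NY YH H by (auto intro!: subgroup_intros)
    have "inv_r a * x = inv_r n * k"
      unfolding x_def by (subst a_eq) (use ra un in \<open>simp add: unit_simps\<close>)
    then have "inv_r a * x \<in> N" using n k N by (simp add: subgroup_intros)
    then have rx: "r x = r a" using r_eq a x by metis
    have "f x = pair_move (r a) k p"
      unfolding f_def rx using ra by (simp add: x_def inv_r_cancel)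
    also have "\<dots> = pair_move (r a * n) h p"
      using ra un ny by (simp add: pair_move_def gk flip: conjugate_conjugate)
    finally have "f x = q" by (simp add: q flip: a_eq)
    then show "q \<in> f ` H" using x by blast
  qed (use r tw in \<open>auto simp: f_def\<close>)
  ultimately show ?thesis unfolding eqpoll_def bij_betw_def N_def by blast
qed

text \<open>Inverses and composites of moves are moves because the core is carried along by
  conjugation. The moves therefore define an equivalence relation on \<open>\<Phi>\<close>, and each
  block has the size of \<open>H\<close> by \<open>block_eqpoll_subgroup\<close>.\<close>

proposition eqpoll_Times_of_invariant:
  fixes \<Phi> :: "('a::ring_1 \<times> 'a list) set"
  assumes H: "units_subgroup H"
    and unit: "\<And>p. p \<in> \<Phi> \<Longrightarrow> is_unit (fst p)"
    and closed: "\<And>p a h. p \<in> \<Phi> \<Longrightarrow> a \<in> H \<Longrightarrow> h \<in> pair_core H p \<Longrightarrow> pair_move a h p \<in> \<Phi>"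
  shows "\<exists>C\<subseteq>\<Phi>. \<Phi> \<approx> H \<times> C"
proof (rule eqpoll_Times_of_blocks[where R = "\<lambda>p q. \<exists>a\<in>H. \<exists>h\<in>pair_core H p. q = pair_move a h p"])
  note N = units_subgroup_pair_core[OF H unit]
  have unitH: "is_unit a" if "a \<in> H" for a using that H units_subgroup_unit by blast
  show "\<exists>a\<in>H. \<exists>h\<in>pair_core H p. p = pair_move a h p" if "p \<in> \<Phi>" for p
    using pair_move_one[of p] units_subgroup_one[OF H] units_subgroup_one[OF N[OF that]] by metis
  show "\<exists>a\<in>H. \<exists>h\<in>pair_core H q. p = pair_move a h q"
    if p: "p \<in> \<Phi>" and ex: "\<exists>a\<in>H. \<exists>h\<in>pair_core H p. q = pair_move a h p" for p q
  proof -
    obtain a h where a: "a \<in> H" and h: "h \<in> pair_core H p" and q: "q = pair_move a h p"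
      using ex by blast
    have "conjugate a (inv_r h) \<in> pair_core H q"
      unfolding q pair_core_move[OF H a unit[OF p] h] using units_subgroup_inv[OF N[OF p] h] by blast
    moreover have "p = pair_move (inv_r a) (conjugate a (inv_r h)) q"
      using unitH[OF a] units_subgroup_unit[OF N[OF p] h]
      by (simp add: q pair_move_move is_unit_inv_r inv_r_props pair_move_one)
    ultimately show ?thesis using units_subgroup_inv[OF H a] by blast
  qed
  show "\<exists>a\<in>H. \<exists>h\<in>pair_core H p. s = pair_move a h p"
    if p: "p \<in> \<Phi>" and ex: "\<exists>a\<in>H. \<exists>h\<in>pair_core H p. q = pair_move a h p"
      "\<exists>a\<in>H. \<exists>h\<in>pair_core H q. s = pair_move a h q" for p q s
  proof -
    obtain a h where a: "a \<in> H" and h: "h \<in> pair_core H p" and q: "q = pair_move a h p"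
      using ex by blast
    obtain b k where b: "b \<in> H" and k: "k \<in> pair_core H p" and s: "s = pair_move b (conjugate a k) q"
      using ex(2) unfolding q pair_core_move[OF H a unit[OF p] h] by blast
    have "s = pair_move (b * a) (h * k) p"
      using unitH a b by (simp add: s q pair_move_move)
    then show ?thesis
      using units_subgroup_mult[OF H b a] units_subgroup_mult[OF N[OF p] h k] by blast
  qed
  show "H \<approx> {q \<in> \<Phi>. \<exists>a\<in>H. \<exists>h\<in>pair_core H p. q = pair_move a h p}" if p: "p \<in> \<Phi>" for p
  proof -
    have "{q \<in> \<Phi>. \<exists>a\<in>H. \<exists>h\<in>pair_core H p. q = pair_move a h p}
      = {q. \<exists>a\<in>H. \<exists>h\<in>pair_core H p. q = pair_move a h p}"
      using closed[OF p] by blast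
    then show ?thesis using block_eqpoll_subgroup[OF H unit[OF p]] by simp
  qed
qed

subsection \<open>Evaluating terms\<close>

lemma eval_term_Nil: "eval_term x [] = 1"
  by (simp add: eval_term_def)

lemma eval_term_Cons: "eval_term x ((c, v, k) # t) = c * zpow (x v) k * eval_term x t"
  by (simp add: eval_term_def)

lemma term_degree_Cons: "term_degree d ((c, v, k) # t) = k * d v + term_degree d t"
  by (simp add: term_degree_def)

lemma eval_term_closed:
  assumes "units_subgroup G" "\<And>c v k. (c, v, k) \<in> set t \<Longrightarrow> c \<in> G \<and> x v \<in> G"
  shows "eval_term x t \<in> G"
  using assms(2)
proof (induction t)
  case Nil
  then show ?case using assms(1) by (simp add: eval_term_Nil units_subgroup_one)
next
  case (Cons f t)
  obtain c v k where f: "f = (c, v, k)" by (cases f)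
  have "eval_term x t \<in> G" by (rule Cons.IH) (use Cons.prems in auto)
  moreover have "c \<in> G" "x v \<in> G" using Cons.prems[of c v k] f by auto
  ultimately show ?case
    using assms(1) by (simp add: f eval_term_Cons units_subgroup_mult units_subgroup_zpow)
qed

lemma eval_term_conjugate:
  assumes "is_unit a"
    and "\<And>c v k. (c, v, k) \<in> set t \<Longrightarrow> conjugate a c = c \<and> is_unit (x v) \<and> x' v = conjugate a (x v)"
  shows "eval_term x' t = conjugate a (eval_term x t)"
  using assms(2)
proof (induction t)
  case Nil
  then show ?case using assms(1) by (simp add: eval_term_Nil conjugate_right_one)
next
  case (Cons f t)
  obtain c v k where f: "f = (c, v, k)" by (cases f)
  have "eval_term x' t = conjugate a (eval_term x t)" by (rule Cons.IH) (use Cons.prems in auto)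
  moreover have "conjugate a c = c" "is_unit (x v)" "x' v = conjugate a (x v)"
    using Cons.prems[of c v k] f by auto
  ultimately show ?case
    using assms(1) by (simp add: f eval_term_Cons conjugate_mult conjugate_zpow)
qed

lemma eval_eqn_conjugate:
  assumes "\<And>t. t \<in> set e \<Longrightarrow> eval_term x' t = conjugate a (eval_term x t)"
  shows "eval_eqn x' e = conjugate a (eval_eqn x e)"
  using assms by (induction e) (simp_all add: eval_eqn_def conjugate_zero conjugate_add)

text \<open>\<open>u\<close> and \<open>u'\<close> are the values, before and after replacing \<open>g\<close> by \<open>g'\<close>, of an expression of degree \<open>k\<close>.\<close>
definition parallel :: "'a::ring_1 set \<Rightarrow> 'a \<Rightarrow> 'a \<Rightarrow> 'a \<Rightarrow> 'a \<Rightarrow> int \<Rightarrow> bool" where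
  "parallel N g g' u u' k \<longleftrightarrow> (\<exists>e\<in>centraliser N. u = e * zpow g k \<and> u' = e * zpow g' k)"

lemma parallel_scalar: "c \<in> centraliser N \<Longrightarrow> parallel N g g' c c 0"
  unfolding parallel_def by (auto simp: zpow_zero)

lemma parallel_zero: "parallel N g g' 0 0 k"
  unfolding parallel_def by (rule bexI[of _ 0]) (auto simp: centraliser_def)

lemma parallel_add:
  assumes "parallel N g g' u u' k" "parallel N g g' v v' k"
  shows "parallel N g g' (u + v) (u' + v') k"
proof -
  obtain e f where "e \<in> centraliser N" "u = e * zpow g k" "u' = e * zpow g' k"
    "f \<in> centraliser N" "v = f * zpow g k" "v' = f * zpow g' k"
    using assms unfolding parallel_def by blast
  then show ?thesis
    unfolding parallel_def by (intro bexI[of _ "e + f"]) (auto simp: centraliser_def algebra_simps)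
qed

text \<open>The power of \<open>g\<close> is invertible, so the common factor \<open>e\<close> must
  be 0. This carries a solved equation through a twist.\<close>

lemma parallel_eq_zero:
  assumes "parallel N g g' 0 u' k" "is_unit g"
  shows "u' = 0"
proof -
  obtain e where e: "0 = e * zpow g k" "u' = e * zpow g' k"
    using assms unfolding parallel_def by blast
  then have "0 * inv_r (zpow g k) = e * zpow g k * inv_r (zpow g k)" by simp
  then show ?thesis using e(2) assms(2) by (simp add: unit_simps is_unit_zpow)
qed

text \<open>Cancelling \<open>g\<close> gives \<open>e = 1\<close>. The lemma is meant for the
  degree 1 monomial whose value is \<open>g\<close>: its value after the change must be
  \<open>g'\<close>.\<close>

lemma parallel_degree_one_self:
  assumes "parallel N g g' g u' 1" "is_unit g"
  shows "u' = g'"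
proof -
  obtain e where e: "g = e * g" "u' = e * g'"
    using assms unfolding parallel_def by (auto simp: zpow_one)
  then have "g * inv_r g = e * g * inv_r g" by simp
  then show ?thesis using e(2) assms(2) by (simp add: unit_simps)
qed

section \<open>Effect of a core twist on the values of terms and equations\<close>

context
  fixes g h :: "'a::ring_1" and Y :: "'a set"
  assumes Y: "units_subgroup Y" and g: "is_unit g" and h: "h \<in> core g Y"
begin

lemma is_unit_core_element: "is_unit h"
  using units_subgroup_unit[OF units_subgroup_core[OF Y g] h] .

text \<open>Conjugation by \<open>g\<close> or its inverse maps the core onto itself, hence
  preserves its centraliser.\<close>

lemma centraliser_core_conjugate:
  assumes e: "e \<in> centraliser (core g Y)"
  shows "conjugate g e \<in> centraliser (core g Y)" "conjugate (inv_r g) e \<in> centraliser (core g Y)"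
proof -
  have "x \<in> conjugate g ` core g Y" "x \<in> conjugate (inv_r g) ` core g Y" if "x \<in> core g Y" for x
    using core_conjugate[OF that] core_conjugate_inv[OF that] conjugate_inv_r_cancel[OF g, of x]
    by (metis imageI)+
  then show "conjugate g e \<in> centraliser (core g Y)" "conjugate (inv_r g) e \<in> centraliser (core g Y)"
    using centraliser_conjugate[OF g e] centraliser_conjugate[OF is_unit_inv_r[OF g] e]
    by (auto simp: centraliser_def)
qed

lemma conjugate_core_centraliser:
  assumes "e \<in> centraliser (core g Y)"
  shows "conjugate h e = e" "conjugate (inv_r h) e = e"
proof -
  note N = units_subgroup_core[OF Y g]
  have "conjugate x e = e" if "x \<in> core g Y" for x
    using assms that units_subgroup_unit[OF N that] by (simp add: conjugate_eq_self_iff centraliser_def)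
  then show "conjugate h e = e" "conjugate (inv_r h) e = e"
    using h units_subgroup_inv[OF N h] by auto
qed

text \<open>Each factor \<open>g * h\<close> acts on the centraliser of the core as \<open>g\<close>
  does, since \<open>h\<close> acts trivially there. Peeling off the rightmost factor replaces
  \<open>e\<close> by a conjugate, so the induction keeps \<open>e\<close> arbitrary.\<close>

lemma conjugate_zpow_twist:
  assumes "e \<in> centraliser (core g Y)"
  shows "conjugate (zpow g k) e \<in> centraliser (core g Y) \<and>
    conjugate (zpow (g * h) k) e = conjugate (zpow g k) e"
  using assms
proof (induction k arbitrary: e rule: int_induct[of _ 0])
  case base
  then show ?case by (simp add: zpow_zero conjugate_one)
next
  case (step1 k)
  have gh: "is_unit (g * h)" using g is_unit_core_element by (rule is_unit_mult)
  have "conjugate (zpow (g * h) (k + 1)) e = conjugate (zpow (g * h) k) (conjugate g (conjugate h e))"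
    using g is_unit_core_element gh
    by (simp add: zpow_succ conjugate_conjugate is_unit_zpow unit_intros mult.assoc)
  also have "\<dots> = conjugate (zpow (g * h) k) (conjugate g e)"
    using conjugate_core_centraliser[OF step1.prems] by simp
  also have "conjugate (zpow g (k + 1)) e = conjugate (zpow g k) (conjugate g e)"
    using g by (simp add: zpow_succ conjugate_conjugate is_unit_zpow)
  ultimately show ?case
    using step1.IH[OF centraliser_core_conjugate(1)[OF step1.prems]] by simp
next
  case (step2 k)
  have gh: "is_unit (g * h)" using g is_unit_core_element by (rule is_unit_mult)
  have "conjugate (zpow (g * h) (k - 1)) e
      = conjugate (zpow (g * h) k) (conjugate (inv_r h) (conjugate (inv_r g) e))"
    using g is_unit_core_element gh
    by (simp add: zpow_pred conjugate_conjugate is_unit_zpow unit_intros inv_r_mult mult.assoc)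
  also have "\<dots> = conjugate (zpow (g * h) k) (conjugate (inv_r g) e)"
    using conjugate_core_centraliser[OF centraliser_core_conjugate(2)[OF step2.prems]] by simp
  also have "conjugate (zpow g (k - 1)) e = conjugate (zpow g k) (conjugate (inv_r g) e)"
    using g by (simp add: zpow_pred conjugate_conjugate is_unit_zpow is_unit_inv_r)
  ultimately show ?case
    using step2.IH[OF centraliser_core_conjugate(2)[OF step2.prems]] by simp
qed

abbreviation "par \<equiv> parallel (core g Y) g (g * h)"

lemma parallel_mult:
  assumes "par u u' j" "par v v' k"
  shows "par (u * v) (u' * v') (j + k)"
proof -
  have gh: "is_unit (g * h)" using g is_unit_core_element by (rule is_unit_mult)
  obtain e f where e: "e \<in> centraliser (core g Y)" "u = e * zpow g j" "u' = e * zpow (g * h) j"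
    and f: "f \<in> centraliser (core g Y)" "v = f * zpow g k" "v' = f * zpow (g * h) k"
    using assms unfolding parallel_def by blast
  \<comment> \<open>Moving the power of \<open>y\<close> past \<open>f\<close> conjugates
    \<open>f\<close>. By \<open>conjugate_zpow_twist\<close> the conjugate is the same for
    \<open>y = g\<close> and \<open>y = g * h\<close>, so both products share their left
    factor.\<close>
  have prod: "e * zpow y j * (f * zpow y k) = e * conjugate (zpow y j) f * zpow y (j + k)"
    if "is_unit y" for y
    using that by (simp add: conjugate_def zpow_add unit_simps is_unit_zpow)
  show ?thesis
    using conjugate_zpow_twist[OF f(1), of j] prod[OF g] prod[OF gh] e f
    unfolding parallel_def
    by (intro bexI[of _ "e * conjugate (zpow g j) f"]) (auto intro: centraliser_mult)
qed

lemma parallel_inv_r: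
  assumes "par u u' k" "is_unit u"
  shows "par (inv_r u) (inv_r u') (- k)"
proof -
  have gh: "is_unit (g * h)" using g is_unit_core_element by (rule is_unit_mult)
  obtain e where e: "e \<in> centraliser (core g Y)" "u = e * zpow g k" "u' = e * zpow (g * h) k"
    using assms unfolding parallel_def by blast
  have "e = u * inv_r (zpow g k)" using g by (simp add: e unit_simps is_unit_zpow)
  then have ue: "is_unit e" using assms(2) g by (simp add: unit_intros is_unit_zpow)
  \<comment> \<open>As for products, moving the power to the right conjugates
    \<open>inv_r e\<close>, with the same result for \<open>g\<close> and
    \<open>g * h\<close>.\<close>
  have inv: "inv_r (e * zpow y k) = conjugate (zpow y (- k)) (inv_r e) * zpow y (- k)"
    if "is_unit y" for y
    using that ue by (simp add: conjugate_def zpow_minus unit_simps is_unit_zpow)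
  show ?thesis
    using conjugate_zpow_twist[OF centraliser_inv_r[OF ue e(1)], of "- k"] inv[OF g] inv[OF gh] e
    unfolding parallel_def
    by (intro bexI[of _ "conjugate (zpow g (- k)) (inv_r e)"]) auto
qed

lemma parallel_zpow:
  assumes "par u u' k" "is_unit u" "is_unit u'"
  shows "par (zpow u m) (zpow u' m) (m * k)"
proof (induction m rule: int_induct[of _ 0])
  case base
  then show ?case by (simp add: zpow_zero parallel_scalar centraliser_one)
next
  case (step1 m)
  from parallel_mult[OF step1.IH assms(1)] show ?case
    using assms by (simp add: zpow_succ distrib_right)
next
  case (step2 m)
  from parallel_mult[OF step2.IH parallel_inv_r[OF assms(1,2)]] show ?case
    using assms by (simp add: zpow_pred left_diff_distrib)
qed

lemma parallel_eval_term:
  assumes "\<And>c v k. (c, v, k) \<in> set t \<Longrightarrow>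
    c \<in> centraliser (core g Y) \<and> is_unit (x v) \<and> is_unit (x' v) \<and> par (x v) (x' v) (d v)"
  shows "par (eval_term x t) (eval_term x' t) (term_degree d t)"
  using assms
proof (induction t)
  case Nil
  then show ?case by (simp add: eval_term_Nil term_degree_def parallel_scalar centraliser_one)
next
  case (Cons f t)
  obtain c v k where f: "f = (c, v, k)" by (cases f)
  have t: "par (eval_term x t) (eval_term x' t) (term_degree d t)"
    by (rule Cons.IH) (use Cons.prems in auto)
  have c: "c \<in> centraliser (core g Y)" and v: "is_unit (x v)" "is_unit (x' v)" "par (x v) (x' v) (d v)"
    using Cons.prems[of c v k] f by auto
  from parallel_mult[OF parallel_mult[OF parallel_scalar[OF c] parallel_zpow[OF v(3,1,2), of k]] t]
  show ?case by (simp add: f eval_term_Cons term_degree_Cons)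
qed

lemma parallel_eval_eqn:
  assumes "\<And>t. t \<in> set e \<Longrightarrow> par (eval_term x t) (eval_term x' t) D"
  shows "par (eval_eqn x e) (eval_eqn x' e) D"
  using assms by (induction e) (simp_all add: eval_eqn_def parallel_zero parallel_add)

end

subsection \<open>Degrees\<close>

text \<open>A Bezout combination of the whole family, that is, a greatest common divisor up to sign,
  built one entry at a time from the two-term identity.\<close>

lemma int_bezout_family:
  fixes d :: "nat \<Rightarrow> int"
  shows "\<exists>m. \<forall>i<n. (\<Sum>j<n. m j * d j) dvd d i"
proof (induction n)
  case (Suc n)
  then obtain m where m: "\<And>i. i < n \<Longrightarrow> (\<Sum>j<n. m j * d j) dvd d i" by blast
  let ?S = "\<Sum>j<n. m j * d j"
  obtain u v where uv: "u * ?S + v * d n = gcd ?S (d n)" using bezout_int by blast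
  define m' where "m' j = (if j < n then u * m j else v)" for j
  have "(\<Sum>j<Suc n. m' j * d j) = gcd ?S (d n)"
    by (simp add: m'_def sum_distrib_left mult.assoc flip: uv)
  moreover have "gcd ?S (d n) dvd d i" if "i < Suc n" for i
    using m[of i] that by (cases "i = n") (auto intro: dvd_trans)
  ultimately show ?case by metis
qed simp

text \<open>Dividing all degrees by their greatest common divisor keeps the system homogeneous and
  makes 1 an integer combination of them.\<close>

lemma gen_homogeneous_primitive:
  assumes "gen_homogeneous n E" "vars_below n E"
  obtains d m :: "nat \<Rightarrow> int" where "(\<Sum>i<n. m i * d i) = 1"
    "\<And>e t1 t2. e \<in> E \<Longrightarrow> t1 \<in> set e \<Longrightarrow> t2 \<in> set e \<Longrightarrow> term_degree d t1 = term_degree d t2"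
proof -
  obtain deg i0 where deg: "i0 < n" "deg i0 \<noteq> 0"
    and hom: "\<And>e t1 t2. e \<in> E \<Longrightarrow> t1 \<in> set e \<Longrightarrow> t2 \<in> set e \<Longrightarrow> term_degree deg t1 = term_degree deg t2"
    using assms(1) unfolding gen_homogeneous_def by blast
  obtain m where m: "\<And>i. i < n \<Longrightarrow> (\<Sum>j<n. m j * deg j) dvd deg i"
    using int_bezout_family by blast
  define D where "D = (\<Sum>j<n. m j * deg j)"
  define d where "d i = deg i div D" for i
  have D: "D \<noteq> 0" using m[OF deg(1)] deg(2) by (auto simp: D_def)
  have d: "deg i = D * d i" if "i < n" for i
    using m[OF that] by (simp add: d_def flip: D_def)
  have "D * (\<Sum>i<n. m i * d i) = (\<Sum>i<n. m i * deg i)"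
    by (simp add: d sum_distrib_left algebra_simps)
  then have sum_one: "(\<Sum>i<n. m i * d i) = 1" using D by (simp flip: D_def)
  \<comment> \<open>\<open>deg i = D * d i\<close> is known for \<open>i < n\<close>, so this uses
    that all unknowns of the system are below \<open>n\<close>.\<close>
  have deg_scale: "term_degree deg t = D * term_degree d t" if "e \<in> E" "t \<in> set e" for e t
  proof -
    have "\<forall>(c, v, k)\<in>set t. v < n" using assms(2) that unfolding vars_below_def by blast
    then show ?thesis
      by (induction t) (auto simp: term_degree_def d algebra_simps)
  qed
  show thesis
  proof (rule that[OF sum_one])
    fix e t1 t2 assume "e \<in> E" "t1 \<in> set e" "t2 \<in> set e"
    with hom deg_scale have "D * term_degree d t1 = D * term_degree d t2" by metis
    then show "term_degree d t1 = term_degree d t2" using D by simp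
  qed
qed

section \<open>Encoding solutions as pairs, and the divisibility\<close>

theorem mainTheorem9:
  fixes G :: "'a::ring_1 set" and E :: "'a eqn set" and n :: nat
  assumes "units_subgroup G"
    and "vars_below n E"
    and "gen_homogeneous n E"
  shows "card_dvd (G \<inter> centraliser (coeffs_of E)) (solutions_in n G E)"
proof -
  define H where "H = G \<inter> centraliser (coeffs_of E)"
  define \<Phi> where "\<Phi> = solutions_in n G E"
  have H: "units_subgroup H" unfolding H_def by (rule units_subgroup_Int_centraliser[OF assms(1)])
  have unitG: "is_unit a" if "a \<in> G" for a using that assms(1) units_subgroup_unit by blast
  obtain d m :: "nat \<Rightarrow> int" where md: "(\<Sum>i<n. m i * d i) = 1"
    and hom: "\<And>e t1 t2. e \<in> E \<Longrightarrow> t1 \<in> set e \<Longrightarrow> t2 \<in> set e \<Longrightarrow> term_degree d t1 = term_degree d t2"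
    by (rule gen_homogeneous_primitive[OF assms(3,2)]) (rule that, assumption, blast)
  \<comment> \<open>The monomial is written as a term with coefficients 1, so that the results on
    evaluating terms apply to it as well.\<close>
  define w :: "'a factor list" where "w = map (\<lambda>i. (1, i, m i)) [0..<n]"
  have w_degree: "term_degree d w = 1"
    using md by (simp add: w_def term_degree_def comp_def interv_sum_list_conv_sum_set_nat atLeast0LessThan)
  have w: "c = 1 \<and> v < n" if "(c, v, k) \<in> set w" for c v k
    using that by (auto simp: w_def)
  define g where "g xs = eval_term (nth xs) w" for xs
  \<comment> \<open>The correcting power brings each entry to degree 0; multiplying by
    \<open>zpow (g xs) (d i)\<close> recovers \<open>xs ! i\<close>.\<close>
  define ys where "ys xs = map (\<lambda>i. xs ! i * zpow (g xs) (- d i)) [0..<n]" for xs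
  define code where "code xs = (g xs, ys xs)" for xs
  have len: "length xs = n" and nth_G: "\<And>i. i < n \<Longrightarrow> xs ! i \<in> G"
    and sol: "\<And>e. e \<in> E \<Longrightarrow> eval_eqn (nth xs) e = 0" if "xs \<in> \<Phi>" for xs
    using that nth_mem[of _ xs] by (auto simp: \<Phi>_def solutions_in_def)
  have g_G: "g xs \<in> G" if "xs \<in> \<Phi>" for xs
    unfolding g_def
    by (rule eval_term_closed[OF assms(1)]) (use w nth_G[OF that] units_subgroup_one[OF assms(1)] in blast)
  have ys_nth: "ys xs ! i = xs ! i * zpow (g xs) (- d i)" "length (ys xs) = n" if "i < n" for xs i
    using that by (simp_all add: ys_def)
  have nth_decode: "xs ! i = ys xs ! i * zpow (g xs) (d i)" if "xs \<in> \<Phi>" "i < n" for xs i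
    using that unitG[OF g_G[OF that(1)]]
    by (simp add: ys_nth zpow_minus unit_simps is_unit_zpow)
  have vars: "v < n" "c \<in> coeffs_of E" if "e \<in> E" "t \<in> set e" "(c, v, k) \<in> set t" for e t c v k
    using that assms(2) unfolding vars_below_def coeffs_of_def by fast+

  \<comment> \<open>Elements of \<open>H\<close> commute with the coefficients, so conjugation
    passes through every term of the system and through the monomial.\<close>
  have code_conjugate: "map (conjugate a) xs \<in> \<Phi> \<and>
      code (map (conjugate a) xs) = (conjugate a (g xs), map (conjugate a) (ys xs))"
    if xs: "xs \<in> \<Phi>" and a: "a \<in> H" for xs a
  proof
    have aG: "a \<in> G" and ua: "is_unit a" using a unitG by (auto simp: H_def)
    let ?xs = "map (conjugate a) xs"
    have nth: "?xs ! i = conjugate a (xs ! i)" "is_unit (xs ! i)" if "i < n" for i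
      using that len[OF xs] nth_G[OF xs that] unitG by auto
    have coeff: "conjugate a c = c" if "c \<in> coeffs_of E" for c
      using that a ua by (auto simp: H_def centraliser_iff_conjugate)
    have "eval_term (nth ?xs) t = conjugate a (eval_term (nth xs) t)" if "e \<in> E" "t \<in> set e" for e t
      using vars[OF that] nth coeff by (intro eval_term_conjugate[OF ua]) blast
    then have "eval_eqn (nth ?xs) e = 0" if "e \<in> E" for e
      using eval_eqn_conjugate[of e "nth ?xs" a "nth xs"] sol[OF xs that] that by (simp add: conjugate_zero)
    then show "?xs \<in> \<Phi>"
      using xs units_subgroup_conjugate[OF assms(1) aG] by (auto simp: \<Phi>_def solutions_in_def)
    have g: "g ?xs = conjugate a (g xs)"
      unfolding g_def using w nth conjugate_right_one[OF ua]
      by (intro eval_term_conjugate[OF ua]) blast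
    have "ys ?xs = map (conjugate a) (ys xs)"
      using nth ua unitG[OF g_G[OF xs]]
      by (auto simp: ys_def g conjugate_mult conjugate_zpow)
    then show "code ?xs = (conjugate a (g xs), map (conjugate a) (ys xs))"
      by (simp add: code_def g)
  qed

  have code_twist: "\<exists>xs'\<in>\<Phi>. code xs' = (g xs * h, ys xs)"
    if xs: "xs \<in> \<Phi>" and h: "h \<in> pair_core H (code xs)" for xs h
  proof
    define Y where "Y = H \<inter> centraliser (set (ys xs))"
    have Y: "units_subgroup Y" unfolding Y_def by (rule units_subgroup_Int_centraliser[OF H])
    have hY: "h \<in> core (g xs) Y" using h by (simp add: pair_core_def code_def Y_def)
    have core_Y: "core (g xs) Y \<subseteq> Y" by (auto dest: core_in)
    have ug: "is_unit (g xs)" using unitG g_G xs by blast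
    have hG: "h \<in> G" using hY core_Y by (auto simp: Y_def H_def)
    have ghG: "g xs * h \<in> G" using units_subgroup_mult[OF assms(1) g_G[OF xs] hG] .
    \<comment> \<open>The candidate is the decoding of \<open>(g xs * h, ys xs)\<close>. What has to
      be shown is that it solves the system and that its own monomial takes the value
      \<open>g xs * h\<close>.\<close>
    define xs' where "xs' = map (\<lambda>i. ys xs ! i * zpow (g xs * h) (d i)) [0..<n]"
    have nth': "xs' ! i = ys xs ! i * zpow (g xs * h) (d i)" if "i < n" for i
      using that by (simp add: xs'_def)
    have ysG: "ys xs ! i \<in> G" if "i < n" for i
      using that nth_G[OF xs that] units_subgroup_zpow[OF assms(1) g_G[OF xs]]
      by (simp add: ys_nth units_subgroup_mult[OF assms(1)])
    have nth'_G: "xs' ! i \<in> G" if "i < n" for i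
      using ysG[OF that] units_subgroup_zpow[OF assms(1) ghG] that
      by (simp add: nth' units_subgroup_mult[OF assms(1)])
    have ys_cent: "ys xs ! i \<in> centraliser (core (g xs) Y)" if "i < n" for i
    proof -
      have "ys xs ! i \<in> set (ys xs)" using that by (simp add: ys_def)
      then show ?thesis using core_Y by (auto simp: Y_def centraliser_def)
    qed
    have coeff: "c \<in> centraliser (core (g xs) Y)" if "c \<in> coeffs_of E" for c
      using that core_Y by (auto simp: Y_def H_def centraliser_def)
    \<comment> \<open>The common left factor is \<open>ys xs ! i\<close>, which commutes with the
      core by the choice of \<open>Y\<close>.\<close>
    have par: "parallel (core (g xs) Y) (g xs) (g xs * h) (xs ! i) (xs' ! i) (d i)" if "i < n" for i
      using that ys_cent[OF that] nth'[OF that] nth_decode[OF xs that] unfolding parallel_def by blast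
    have par_term: "parallel (core (g xs) Y) (g xs) (g xs * h)
        (eval_term (nth xs) t) (eval_term (nth xs') t) (term_degree d t)"
      if "\<And>c v k. (c, v, k) \<in> set t \<Longrightarrow> c \<in> centraliser (core (g xs) Y) \<and> v < n" for t
      using that par nth_G[OF xs] nth'_G unitG by (intro parallel_eval_term[OF Y ug hY]) blast
    have g': "g xs' = g xs * h"
    proof (rule parallel_degree_one_self[OF _ ug])
      show "parallel (core (g xs) Y) (g xs) (g xs * h) (g xs) (g xs') 1"
        using par_term[of w] w centraliser_one unfolding w_degree g_def by blast
    qed
    have "eval_eqn (nth xs') e = 0" if e: "e \<in> E" for e
    proof -
      \<comment> \<open>Homogeneity gives one degree for all terms of \<open>e\<close>; if there are
        no terms, any \<open>D\<close> will do.\<close>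
      obtain D where D: "term_degree d t = D" if "t \<in> set e" for t
        using hom[OF e] by metis
      have "parallel (core (g xs) Y) (g xs) (g xs * h) (eval_eqn (nth xs) e) (eval_eqn (nth xs') e) D"
        using par_term vars[OF e] coeff D by (intro parallel_eval_eqn[OF Y ug hY]) metis
      then show ?thesis unfolding sol[OF xs e] using ug by (rule parallel_eq_zero)
    qed
    then show "xs' \<in> \<Phi>"
      using nth'_G by (auto simp: \<Phi>_def solutions_in_def in_set_conv_nth xs'_def)
    have "ys xs' = ys xs"
    proof (rule nth_equalityI)
      fix i assume "i < length (ys xs')"
      then have i: "i < n" by (simp add: ys_def)
      show "ys xs' ! i = ys xs ! i"
        using i unitG[OF ghG] by (simp add: ys_nth(1)[of i xs'] g' nth' zpow_minus unit_simps is_unit_zpow)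
    qed (simp add: ys_def)
    then show "code xs' = (g xs * h, ys xs)" by (simp add: code_def g')
  qed

  have "inj_on code \<Phi>"
  proof (rule inj_onI)
    fix xs xs' assume xs: "xs \<in> \<Phi>" "xs' \<in> \<Phi>" "code xs = code xs'"
    then show "xs = xs'"
      using len nth_decode by (intro nth_equalityI) (auto simp: code_def)
  qed
  then have code_eqpoll: "code ` \<Psi> \<approx> \<Psi>" if "\<Psi> \<subseteq> \<Phi>" for \<Psi>
    using that by (meson inj_on_image_eqpoll_self inj_on_subset)
  have "\<exists>C\<subseteq>code ` \<Phi>. code ` \<Phi> \<approx> H \<times> C"
  proof (rule eqpoll_Times_of_invariant[OF H])
    show "is_unit (fst p)" if "p \<in> code ` \<Phi>" for p
      using that unitG g_G by (auto simp: code_def)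
    show "pair_move a h p \<in> code ` \<Phi>" if p: "p \<in> code ` \<Phi>" and a: "a \<in> H" and h: "h \<in> pair_core H p"
      for p a h
    proof -
      obtain xs where xs: "xs \<in> \<Phi>" "p = code xs" using p by blast
      obtain xs' where xs': "xs' \<in> \<Phi>" "code xs' = (g xs * h, ys xs)"
        using code_twist[OF xs(1)] h xs(2) by blast
      \<comment> \<open>A move is a twist followed by a conjugation, and both have been realised on
        solutions.\<close>
      have "pair_move a h p = code (map (conjugate a) xs')"
        using code_conjugate[OF xs'(1) a] xs'(2) by (simp add: pair_move_def xs(2) code_def)
      then show ?thesis using code_conjugate[OF xs'(1) a] by blast
    qed
  qed
  \<comment> \<open>The second factor is the image of a set of solutions, so it can be exchanged for
    a set of the type that \<open>card_dvd\<close> requires.\<close>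
  then obtain \<Psi> where \<Psi>: "\<Psi> \<subseteq> \<Phi>" "code ` \<Phi> \<approx> H \<times> code ` \<Psi>"
    by (metis subset_imageE)
  have "\<Phi> \<approx> code ` \<Phi>" using eqpoll_sym[OF code_eqpoll] by blast
  also note \<Psi>(2)
  also have "H \<times> code ` \<Psi> \<approx> H \<times> \<Psi>"
    by (intro times_eqpoll_cong eqpoll_refl code_eqpoll \<Psi>(1))
  finally show ?thesis unfolding card_dvd_def \<Phi>_def[symmetric] H_def[symmetric] by blast
qed

end
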